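(* For every integer $n \geq 4$, the star $K_{1,n-1}$ is not solvable in reversible peg solitaire.
   Context: Reversible peg solitaire on a finite simple graph $G$: a configuration assigns to each vertex either a peg or a hole. If $xyz$ is a path in $G$ (i.e., $x$ is adjacent to $y$ and $y$ is adjacent to $z$, with $x,y,z$ distinct), then a jump is allowed when $x$ and $y$ have pegs and $z$ has a hole: it removes the pegs from $x$ and $y$ and places a peg on $z$. An unjump is the reverse move: when $x$ and $y$ have holes and $z$ has a peg, it removes the peg from $z$ and places pegs on $x$ and $y$. A graph $G$ is solvable if, for some starting configuration with exactly one hole (pegs on all other vertices), some finite sequence of jumps and unjumps produces a configuration with exactly one peg. $K_{1,n-1}$ denotes the star on $n$ vertices. *)

theory Defs
  imports "Graph_Theory.Kuratowski"
begin

text \<open>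
  A finite simple graph is a term \<open>G\<close> satisfying the locale predicate \<open>graph\<close> (a finite, loop-free
  symmetric digraph without parallel arcs). A configuration is represented by the set of vertices
  that carry a peg; the holes are the remaining vertices.
\<close>

definition path3 :: "('a, 'b) pre_digraph \<Rightarrow> 'a \<Rightarrow> 'a \<Rightarrow> 'a \<Rightarrow> bool" where
  "path3 G x y z \<longleftrightarrow> x \<rightarrow>\<^bsub>G\<^esub> y \<and> y \<rightarrow>\<^bsub>G\<^esub> z \<and> distinct [x, y, z]"

definition jump :: "('a, 'b) pre_digraph \<Rightarrow> 'a set \<Rightarrow> 'a set \<Rightarrow> bool" where
  "jump G S T \<longleftrightarrow> (\<exists>x y z. path3 G x y z \<and> x \<in> S \<and> y \<in> S \<and> z \<notin> S \<and> T = insert z (S - {x, y}))"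

definition unjump :: "('a, 'b) pre_digraph \<Rightarrow> 'a set \<Rightarrow> 'a set \<Rightarrow> bool" where
  "unjump G S T \<longleftrightarrow> (\<exists>x y z. path3 G x y z \<and> x \<notin> S \<and> y \<notin> S \<and> z \<in> S \<and> T = S - {z} \<union> {x, y})"

definition solvable :: "('a, 'b) pre_digraph \<Rightarrow> bool" where
  "solvable G \<longleftrightarrow> (\<exists>v \<in> verts G. \<exists>w \<in> verts G.
     (\<lambda>S T. jump G S T \<or> unjump G S T)\<^sup>*\<^sup>* (verts G - {v}) {w})"

end

theory Submission
  imports Defs
begin

text \<open>
  Every path of length two in a star runs through its centre, so a jump or unjump moves a peg from
  one leaf to another while toggling the centre. Hence the number of pegs on the leaves is
  invariant; it is at least \<open>n - 2\<close> at the start and would be at most \<open>1\<close> at the end.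
\<close>

text \<open>Every arc joins \<open>c\<close> to a leaf, so a leaf as midpoint would force
  \<open>x = c = z\<close>, against distinctness.\<close>

lemma path3_star:
  assumes "arcs_ends G = {c} \<times> L \<union> L \<times> {c}" "c \<notin> L" "path3 G x y z"
  shows "y = c" "x \<in> L" "z \<in> L" "x \<noteq> z"
  using assms unfolding path3_def by auto

text \<open>Serves both kinds of move: a jump carries a leaf peg from \<open>x\<close> to
  \<open>z\<close>, an unjump carries one from \<open>z\<close> to \<open>x\<close>.\<close>

lemma card_move_leaf:
  assumes "finite L" "x \<in> L" "x \<in> S" "z \<in> L" "z \<notin> S"
  shows "card (insert z (S \<inter> L - {x})) = card (S \<inter> L)"
proof -
  have "card (insert z (S \<inter> L - {x})) = Suc (card (S \<inter> L - {x}))"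
    using assms by (intro card_insert_disjoint) auto
  also have "\<dots> = card (S \<inter> L)"
    using assms by (intro card_Suc_Diff1) auto
  finally show ?thesis .
qed

lemma jump_or_unjump_card_leaves:
  assumes star: "arcs_ends G = {c} \<times> L \<union> L \<times> {c}" "c \<notin> L" and "finite L"
    and "jump G S T \<or> unjump G S T"
  shows "card (T \<inter> L) = card (S \<inter> L)"
  using assms(4)
proof
  assume "jump G S T"
  then obtain x y z where p: "path3 G x y z" and S: "x \<in> S" "z \<notin> S"
    and T: "T = insert z (S - {x, y})"
    unfolding jump_def by blast
  note xyz = path3_star[OF star p]
  \<comment> \<open>Since \<open>y = c\<close> lies outside \<open>L\<close>, the change at the
    centre vanishes on intersecting with \<open>L\<close>.\<close>
  have "T \<inter> L = insert z (S \<inter> L - {x})"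
    using T xyz star(2) by auto
  then show ?thesis
    using card_move_leaf[OF assms(3)] S xyz by simp
next
  assume "unjump G S T"
  then obtain x y z where p: "path3 G x y z" and S: "x \<notin> S" "z \<in> S"
    and T: "T = S - {z} \<union> {x, y}"
    unfolding unjump_def by blast
  note xyz = path3_star[OF star p]
  have "T \<inter> L = insert x (S \<inter> L - {z})"
    using T xyz star(2) by auto
  then show ?thesis
    using card_move_leaf[OF assms(3)] S xyz by simp
qed

lemma jumps_and_unjumps_card_leaves:
  assumes "arcs_ends G = {c} \<times> L \<union> L \<times> {c}" "c \<notin> L" "finite L"
    and "(\<lambda>S T. jump G S T \<or> unjump G S T)\<^sup>*\<^sup>* S T"
  shows "card (T \<inter> L) = card (S \<inter> L)"
  using assms(4) jump_or_unjump_card_leaves[OF assms(1-3)]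
  by (induction rule: rtranclp_induct) auto

theorem theorem1:
  fixes G :: "('a, 'b) pre_digraph" and n :: nat
  assumes "n \<ge> 4" and "complete_bipartite_digraph 1 (n - 1) G"
  shows "\<not> solvable G"
proof
  obtain U L where G: "graph G" and V: "verts G = U \<union> L" and UL: "U \<inter> L = {}"
    and "card U = 1" and cL: "card L = n - 1" and E: "arcs_ends G = U \<times> L \<union> L \<times> U"
    using assms(2) unfolding complete_bipartite_digraph_def by auto
  then obtain c where U: "U = {c}"
    using card_1_singletonE by blast
  \<comment> \<open>Finiteness: \<open>card L = n - 1\<close> is positive, whereas
    \<open>card\<close> of an infinite set is 0.\<close>
  have star: "arcs_ends G = {c} \<times> L \<union> L \<times> {c}" "c \<notin> L" and fin: "finite L"
    using E UL U cL assms(1) card.infinite[of L] by auto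
  assume "solvable G"
  then obtain v w where
    "(\<lambda>S T. jump G S T \<or> unjump G S T)\<^sup>*\<^sup>* (verts G - {v}) {w}"
    unfolding solvable_def by blast
  then have "card ({w} \<inter> L) = card ((verts G - {v}) \<inter> L)"
    using jumps_and_unjumps_card_leaves[OF star fin] by blast
  moreover have "card ({w} \<inter> L) \<le> 1"
    using card_mono[of "{w}" "{w} \<inter> L"] by simp
  moreover have "(verts G - {v}) \<inter> L = L - {v}"
    using V by auto
  \<comment> \<open>The worst case is a hole at a leaf; if \<open>v\<close> is the centre, all
    \<open>n - 1\<close> leaves carry pegs. As \<open>n \<ge> 4\<close>, the bound is at least 2,
    more than the final count allows.\<close>
  moreover have "card (L - {v}) \<ge> n - 2"
    using cL diff_card_le_card_Diff[of "{v}" L] by simp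
  ultimately show False
    using assms(1) by simp
qed

end
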